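(* Let $A_0A_1\dots A_n$ be a lattice oriented broken line on unit distance from a lattice point $V_1$ and $B_0B_1\dots B_n$ a lattice oriented broken line on unit distance from a lattice point $V_2$. Their signed length-sine sequences (relative to $V_1$ and $V_2$ respectively) coincide if and only if there exists a proper lattice-affine transformation $\xi$ with $\xi(V_1)=V_2$ and $\xi(A_i)=B_i$ for all $i=0,\dots,n$.
   Context: We work in $\mathbb R^2$ with standard orientation and lattice $\mathbb Z^2$. A proper lattice-affine transformation is $x\mapsto Mx+b$ with $M\in GL_2(\mathbb Z)$, $\det M=1$, $b\in\mathbb Z^2$. For distinct lattice points $A,B$, $\operatorname{l\ell}(AB)$ is the number of lattice points on segment $AB$ minus one. $\operatorname{sgn}(A,B,C)\in\{1,0,-1\}$ is the sign of $\det(A-B,C-B)$. For an ordinary lattice angle $\angle XOY$ (lattice points, not collinear), let $v_1,v_2$ be primitive lattice vectors along $OX$, $OY$; the lattice points $P$ with $(v_1,P-O)$ a basis form two lines parallel to $OX$; ray $OY$ meets exactly one, $l$, at $Q$; let $D$ be the lattice point of $l$ nearest $Q$ among those strictly on the other side of line $OY$ from $X$; writing $v_2=x_1v_1+x_2(D-O)$, $\operatorname{lsin}\angle XOY=x_2$. A lattice oriented broken line $A_0A_1\dots A_n$ ($n\ge1$) is a sequence of lattice points with $A_{i-1}\ne A_i$ and no two consecutive segments contained in a common line. It is on unit distance from a lattice point $V$ if for every $i$ the primitive lattice vector along $A_{i-1}A_i$ and $V-A_{i-1}$ form a basis of $\mathbb Z^2$. Its signed length-sine sequence relative to $V$ is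 $(a_0,\dots,a_{2n-2})$ with $a_{2i-2}=\operatorname{sgn}(A_{i-1},V,A_i)\operatorname{l\ell}(A_{i-1}A_i)$ ($1\le i\le n$) and $a_{2i-1}=\operatorname{sgn}(A_{i-1},V,A_i)\operatorname{sgn}(A_i,V,A_{i+1})\operatorname{sgn}(A_{i-1},A_i,A_{i+1})\operatorname{lsin}\angle A_{i-1}A_iA_{i+1}$ ($1\le i\le n-1$). *)

theory Defs
  imports "HOL-Analysis.Analysis"
begin

definition lattice :: "(real^2) set" where
  "lattice = {x. \<forall>i. x $ i \<in> \<int>}"

definition int_matrix :: "real^2^2 \<Rightarrow> bool" where
  "int_matrix M \<longleftrightarrow> (\<forall>i j. M $ i $ j \<in> \<int>)"

definition GL2_int :: "(real^2^2) set" where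
  "GL2_int = {M. int_matrix M \<and> (\<exists>N. int_matrix N \<and> M ** N = mat 1 \<and> N ** M = mat 1)}"

definition proper_lattice_affine :: "(real^2 \<Rightarrow> real^2) \<Rightarrow> bool" where
  "proper_lattice_affine \<xi> \<longleftrightarrow>
     (\<exists>M b. M \<in> GL2_int \<and> det M = 1 \<and> b \<in> lattice \<and> \<xi> = (\<lambda>x. M *v x + b))"

definition lattice_length :: "real^2 \<Rightarrow> real^2 \<Rightarrow> real" where
  "lattice_length A B = real (card (closed_segment A B \<inter> lattice)) - 1"

definition osgn :: "real^2 \<Rightarrow> real^2 \<Rightarrow> real^2 \<Rightarrow> real" where
  "osgn A B C = sgn (det (vector [A - B, C - B] :: real^2^2))"

definition primitive_vector :: "real^2 \<Rightarrow> bool" where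
  "primitive_vector v \<longleftrightarrow> v \<noteq> 0 \<and> closed_segment 0 v \<inter> lattice = {0, v}"

definition primitive_along :: "real^2 \<Rightarrow> real^2 \<Rightarrow> real^2" where
  "primitive_along A B = (THE v. primitive_vector v \<and> (\<exists>c>0. B - A = c *\<^sub>R v))"

definition lattice_basis :: "real^2 \<Rightarrow> real^2 \<Rightarrow> bool" where
  "lattice_basis u v \<longleftrightarrow>
     bij_betw (\<lambda>(m::int, n::int). of_int m *\<^sub>R u + of_int n *\<^sub>R v) UNIV lattice"

definition ray :: "real^2 \<Rightarrow> real^2 \<Rightarrow> (real^2) set" where
  "ray A B = {A + t *\<^sub>R (B - A) | t. t \<ge> 0}"

text \<open>The four definitions below construct the lattice sine of the angle \<open>XOY\<close>: the line \<open>l\<close>,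
  the point \<open>Q\<close>, the point \<open>D\<close>, and finally the coefficient of \<open>D - O\<close>. The descriptions are
  meaningful only if \<open>X\<close>, \<open>O\<close>, \<open>Y\<close> are non-collinear lattice points.\<close>

definition lsin_line :: "real^2 \<Rightarrow> real^2 \<Rightarrow> real^2 \<Rightarrow> (real^2) set" where
  "lsin_line X O' Y =
     (THE l. (\<exists>P\<in>lattice. lattice_basis (primitive_along O' X) (P - O') \<and>
                 l = affine hull {P, P + primitive_along O' X}) \<and>
             l \<inter> ray O' Y \<noteq> {})"

definition lsin_Q :: "real^2 \<Rightarrow> real^2 \<Rightarrow> real^2 \<Rightarrow> real^2" where
  "lsin_Q X O' Y = (THE Q. Q \<in> lsin_line X O' Y \<inter> ray O' Y)"

definition lsin_D :: "real^2 \<Rightarrow> real^2 \<Rightarrow> real^2 \<Rightarrow> real^2" where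
  "lsin_D X O' Y =
     arg_min (dist (lsin_Q X O' Y))
       (\<lambda>D. D \<in> lsin_line X O' Y \<and> D \<in> lattice \<and> osgn X O' Y * osgn D O' Y < 0)"

definition lsin :: "real^2 \<Rightarrow> real^2 \<Rightarrow> real^2 \<Rightarrow> real" where
  "lsin X O' Y =
     (THE x2. \<exists>x1. primitive_along O' Y =
                   x1 *\<^sub>R primitive_along O' X + x2 *\<^sub>R (lsin_D X O' Y - O'))"

text \<open>A broken line with vertices \<open>A 0, \<dots>, A n\<close> is given by \<open>n\<close> and a function \<open>A\<close> whose
  values beyond \<open>n\<close> are irrelevant.\<close>

definition lattice_broken_line :: "nat \<Rightarrow> (nat \<Rightarrow> real^2) \<Rightarrow> bool" where
  "lattice_broken_line n A \<longleftrightarrow>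
     n \<ge> 1 \<and>
     (\<forall>i\<le>n. A i \<in> lattice) \<and>
     (\<forall>i\<in>{1..n}. A (i - 1) \<noteq> A i) \<and>
     (\<forall>i\<in>{1..<n}. \<not> collinear (closed_segment (A (i - 1)) (A i) \<union> closed_segment (A i) (A (i + 1))))"

definition on_unit_distance :: "nat \<Rightarrow> (nat \<Rightarrow> real^2) \<Rightarrow> real^2 \<Rightarrow> bool" where
  "on_unit_distance n A V \<longleftrightarrow>
     (\<forall>i\<in>{1..n}. lattice_basis (primitive_along (A (i - 1)) (A i)) (V - A (i - 1)))"

text \<open>The list \<open>[a\<^sub>0, \<dots>, a\<^bsub>2n-2\<^esub>]\<close>. With \<open>j = k div 2\<close>, the entry at \<open>k = 2j\<close> belongs to the
  segment from \<open>A j\<close> to \<open>A (j + 1)\<close>, and the entry at \<open>k = 2j + 1\<close> to the angle at \<open>A (j + 1)\<close>.\<close>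

definition signed_length_sine :: "nat \<Rightarrow> (nat \<Rightarrow> real^2) \<Rightarrow> real^2 \<Rightarrow> real list" where
  "signed_length_sine n A V =
     map (\<lambda>k. let j = k div 2 in
            if even k
            then osgn (A j) V (A (j + 1)) * lattice_length (A j) (A (j + 1))
            else osgn (A j) V (A (j + 1)) * osgn (A (j + 1)) V (A (j + 2))
                 * osgn (A j) (A (j + 1)) (A (j + 2)) * lsin (A j) (A (j + 1)) (A (j + 2)))
       [0..<2 * n - 1]"

end

theory Submission
  imports Defs
begin

text \<open>
  Put \<open>p i = A i - V\<close> and let \<open>u i\<close> be the primitive vector along the \<open>i\<close>-th segment, with the sign
  that makes \<open>det (p i, u i) = 1\<close>; unit distance from \<open>V\<close> says that this determinant is a sign in the
  first place. Since the lattice sine is the absolute value of the determinant of the two primitive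
  vectors, the signed length-sine sequence \<open>a\<close> satisfies \<open>a (2 i) = det (p i, p (i + 1))\<close> and
  \<open>a (2 i + 1) = - det (u i, u (i + 1))\<close>, which are invariant under \<open>SL\<^sub>2(\<int>)\<close>.
  Conversely \<open>p (i + 1) = p i + a (2 i) u i\<close> and \<open>u (i + 1) = u i + a (2 i + 1) p (i + 1)\<close>, so
  the broken line is recovered from \<open>a\<close> and the positively oriented basis \<open>(p 0, u 0)\<close>, and any two
  such bases differ by an element of \<open>SL\<^sub>2(\<int>)\<close>.
\<close>

section \<open>The determinant of two plane vectors\<close>

definition cross2 :: "real^2 \<Rightarrow> real^2 \<Rightarrow> real" where
  "cross2 x y = x $ 1 * y $ 2 - x $ 2 * y $ 1"

lemma cross2_simps:
  "cross2 (x + y) z = cross2 x z + cross2 y z"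
  "cross2 z (x + y) = cross2 z x + cross2 z y"
  "cross2 (x - y) z = cross2 x z - cross2 y z"
  "cross2 z (x - y) = cross2 z x - cross2 z y"
  "cross2 (c *\<^sub>R x) z = c * cross2 x z"
  "cross2 z (c *\<^sub>R x) = c * cross2 z x"
  "cross2 (- x) z = - cross2 x z"
  "cross2 z (- x) = - cross2 z x"
  "cross2 x x = 0"
  "cross2 0 x = 0"
  "cross2 x 0 = 0"
  by (auto simp: cross2_def algebra_simps)

lemma cross2_skew: "cross2 y x = - cross2 x y"
  by (simp add: cross2_def)

lemma osgn_eq_cross2: "osgn A B C = sgn (cross2 (A - B) (C - B))"
  by (simp add: osgn_def cross2_def det_2 vector_2)

text \<open>Cramer's rule with the denominator cleared, hence a polynomial identity valid for
  dependent \<open>p\<close>, \<open>u\<close> as well. It supplies coordinates wherever a vector is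
  expanded in a basis.\<close>

lemma cross2_decomp: "cross2 p u *\<^sub>R x = cross2 x u *\<^sub>R p + cross2 p x *\<^sub>R u"
  by (simp add: cross2_def vec_eq_iff forall_2 algebra_simps)

lemma cross2_eq_0_imp_scaleR:
  assumes "cross2 v z = 0" "v \<noteq> 0"
  obtains c where "z = c *\<^sub>R v"
proof -
  consider "v $ 1 \<noteq> 0" | "v $ 2 \<noteq> 0"
    using assms(2) by (auto simp: vec_eq_iff forall_2)
  then show thesis
  proof cases
    case 1
    with assms(1) have "z = (z $ 1 / v $ 1) *\<^sub>R v"
      by (simp add: cross2_def vec_eq_iff forall_2 field_simps)
    then show ?thesis by (rule that)
  next
    case 2
    with assms(1) have "z = (z $ 2 / v $ 2) *\<^sub>R v"
      by (simp add: cross2_def vec_eq_iff forall_2 field_simps)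
    then show ?thesis by (rule that)
  qed
qed

section \<open>Lattice points and lattice bases\<close>

lemma lattice_closed:
  "0 \<in> lattice"
  "x \<in> lattice \<Longrightarrow> y \<in> lattice \<Longrightarrow> x + y \<in> lattice"
  "x \<in> lattice \<Longrightarrow> y \<in> lattice \<Longrightarrow> x - y \<in> lattice"
  "x \<in> lattice \<Longrightarrow> - x \<in> lattice"
  "c \<in> \<int> \<Longrightarrow> x \<in> lattice \<Longrightarrow> c *\<^sub>R x \<in> lattice"
  by (auto simp: lattice_def)

lemma cross2_Ints: "x \<in> lattice \<Longrightarrow> y \<in> lattice \<Longrightarrow> cross2 x y \<in> \<int>"
  by (auto simp: lattice_def cross2_def)

lemma Ints_mult_eq_1_imp_abs:
  fixes a b :: real
  assumes "a \<in> \<int>" "b \<in> \<int>" "a * b = 1"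
  shows "\<bar>a\<bar> = 1"
proof -
  obtain m k where mk: "a = of_int m" "b = of_int k"
    using assms by (auto elim!: Ints_cases)
  with assms have "m * k = 1"
    by (metis of_int_eq_1_iff of_int_mult)
  then have "\<bar>m\<bar> = 1"
    by (metis abs_zmult_eq_1 abs_1)
  then show ?thesis
    using mk by (metis of_int_1 of_int_abs)
qed

text \<open>If \<open>u\<close>, \<open>v\<close> generate the lattice, writing the standard basis
  in terms of them factors 1 as \<open>cross2 u v\<close> times an integer. Conversely a determinant
  that is a sign is its own inverse, so Cramer's rule gives integer coordinates.\<close>

lemma lattice_basis_iff:
  "lattice_basis u v \<longleftrightarrow> u \<in> lattice \<and> v \<in> lattice \<and> \<bar>cross2 u v\<bar> = 1"
proof
  assume "lattice_basis u v"
  then have im: "range (\<lambda>(m::int, n::int). of_int m *\<^sub>R u + of_int n *\<^sub>R v) = lattice"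
    by (simp add: lattice_basis_def bij_betw_def)
  have comb: "of_int m *\<^sub>R u + of_int n *\<^sub>R v \<in> lattice" for m n :: int
    unfolding im[symmetric] by (rule range_eqI[of _ _ "(m, n)"]) simp
  have u: "u \<in> lattice" and v: "v \<in> lattice"
    using comb[of 1 0] comb[of 0 1] by auto
  have "axis 1 1 \<in> lattice" "axis 2 1 \<in> lattice"
    by (auto simp: lattice_def axis_def)
  then obtain m n m' n' :: int
    where e1: "(axis 1 1 :: real^2) = of_int m *\<^sub>R u + of_int n *\<^sub>R v"
      and e2: "(axis 2 1 :: real^2) = of_int m' *\<^sub>R u + of_int n' *\<^sub>R v"
    unfolding im[symmetric] by auto
  have "1 = cross2 (axis 1 1) (axis 2 1)"
    by (simp add: cross2_def axis_def)
  also have "\<dots> = cross2 u v * (of_int m * of_int n' - of_int n * of_int m')"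
    unfolding e1 e2 by (simp add: cross2_simps cross2_skew[of v u] algebra_simps)
  finally have "\<bar>cross2 u v\<bar> = 1"
    by (intro Ints_mult_eq_1_imp_abs[OF cross2_Ints[OF u v]]) auto
  with u v show "u \<in> lattice \<and> v \<in> lattice \<and> \<bar>cross2 u v\<bar> = 1" by simp
next
  assume "u \<in> lattice \<and> v \<in> lattice \<and> \<bar>cross2 u v\<bar> = 1"
  then have u: "u \<in> lattice" and v: "v \<in> lattice" and d: "\<bar>cross2 u v\<bar> = 1" by auto
  let ?f = "\<lambda>(m::int, n::int). of_int m *\<^sub>R u + of_int n *\<^sub>R v"
  let ?e = "cross2 u v"
  have e: "?e * ?e = 1" "?e \<noteq> 0"
    using d by (auto simp: abs_if split: if_splits)
  have coord: "cross2 (?f (m, n)) v = of_int m * ?e" "cross2 u (?f (m, n)) = of_int n * ?e" for m n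
    by (simp_all add: cross2_simps)
  have "inj ?f"
  proof (rule injI)
    fix x y :: "int \<times> int"
    assume eq: "?f x = ?f y"
    obtain m n m' n' where xy: "x = (m, n)" "y = (m', n')" by fastforce
    show "x = y"
      using coord[of m n] coord[of m' n'] eq e(2) unfolding xy by simp
  qed
  moreover have "range ?f = lattice"
  proof
    show "range ?f \<subseteq> lattice"
      using u v by (auto intro!: lattice_closed)
    show "lattice \<subseteq> range ?f"
    proof
      fix x :: "real^2" assume x: "x \<in> lattice"
      obtain m n :: int where mn: "?e * cross2 x v = of_int m" "?e * cross2 u x = of_int n"
        using Ints_mult cross2_Ints x u v by (metis Ints_cases)
      have "x = ?e *\<^sub>R (?e *\<^sub>R x)" using e by simp
      also have "\<dots> = of_int m *\<^sub>R u + of_int n *\<^sub>R v"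
        unfolding cross2_decomp[of u v x] by (simp add: scaleR_right_distrib mn)
      finally show "x \<in> range ?f"
        by (intro range_eqI[of _ _ "(m, n)"]) simp
    qed
  qed
  ultimately show "lattice_basis u v"
    by (simp add: lattice_basis_def bij_betw_def)
qed

section \<open>Primitive vectors and lattice length\<close>

lemma scaleR_in_lattice_imp_Ints:
  assumes "w \<in> lattice" "cross2 v w = 1" "t *\<^sub>R v \<in> lattice"
  shows "t \<in> \<int>"
  using cross2_Ints[OF assms(3,1)] assms(2) by (simp add: cross2_simps)

text \<open>Pairing with \<open>w\<close> reads off the coefficient of a multiple of
  \<open>v\<close>, so only integer multiples are lattice points, and those with coefficient in
  [0, 1] are the two endpoints.\<close>

lemma primitive_vector_unimodular:
  assumes "v \<in> lattice" "w \<in> lattice" "cross2 v w = 1"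
  shows "primitive_vector v"
  unfolding primitive_vector_def
proof
  show "v \<noteq> 0" using assms(3) by (auto simp: cross2_simps)
  show "closed_segment 0 v \<inter> lattice = {0, v}"
  proof
    show "closed_segment 0 v \<inter> lattice \<subseteq> {0, v}"
    proof
      fix x assume "x \<in> closed_segment 0 v \<inter> lattice"
      then obtain t where t: "0 \<le> t" "t \<le> 1" "x = t *\<^sub>R v" "t *\<^sub>R v \<in> lattice"
        by (auto simp: closed_segment_def)
      then obtain k :: int where "t = of_int k"
        using scaleR_in_lattice_imp_Ints[OF assms(2,3)] by (auto elim: Ints_cases)
      with t have "k = 0 \<or> k = 1" by auto
      with t \<open>t = of_int k\<close> show "x \<in> {0, v}" by auto
    qed
  qed (use assms lattice_closed in auto)
qed

text \<open>The shorter of two parallel primitive vectors is a nonzero lattice point on the segment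
  from 0 to the longer one, hence equals it.\<close>

lemma primitive_vector_unique:
  assumes "primitive_vector v" "primitive_vector v'" "c > 0" "v' = c *\<^sub>R v"
  shows "v' = v"
proof -
  have le: "a = b" if "primitive_vector a" "primitive_vector b" "0 < c" "c \<le> 1" "b = c *\<^sub>R a" for a b c
  proof -
    have "b \<in> closed_segment 0 a"
      using that by (auto simp: closed_segment_def)
    moreover have "b \<in> lattice" "b \<noteq> 0"
      using that(2) by (auto simp: primitive_vector_def)
    ultimately show ?thesis
      using that(1) by (auto simp: primitive_vector_def)
  qed
  show ?thesis
  proof (cases "c \<le> 1")
    case True
    then show ?thesis using le[OF assms(1,2,3) _ assms(4)] by simp
  next
    case False
    moreover have "v = (1 / c) *\<^sub>R v'" using assms(3) by (simp add: assms(4))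
    ultimately show ?thesis using le[OF assms(2,1), of "1 / c"] by simp
  qed
qed

lemma primitive_along_eq:
  assumes "v \<in> lattice" "w \<in> lattice" "cross2 v w = 1" "c > 0" "B - A = c *\<^sub>R v"
  shows "primitive_along A B = v"
  unfolding primitive_along_def
proof (rule the_equality)
  have v: "primitive_vector v" by (rule primitive_vector_unimodular[OF assms(1-3)])
  then show "primitive_vector v \<and> (\<exists>c>0. B - A = c *\<^sub>R v)" using assms by auto
  fix v' assume v': "primitive_vector v' \<and> (\<exists>c>0. B - A = c *\<^sub>R v')"
  then obtain c' where c': "c' > 0" "c *\<^sub>R v = c' *\<^sub>R v'" using assms(5) by auto
  then have "v' = (1 / c') *\<^sub>R (c *\<^sub>R v)" by simp
  then have "v' = (c / c') *\<^sub>R v" by simp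
  then show "v' = v"
    using primitive_vector_unique[OF v, of v' "c / c'"] v' c' assms(4) by simp
qed

text \<open>The lattice points of the segment are \<open>A + real k *\<^sub>R v\<close> for k from 0
  to \<open>g\<close>. These are \<open>g + 1\<close> points, and the definition subtracts
  one.\<close>

lemma lattice_length_eq:
  fixes g :: nat
  assumes "A \<in> lattice" "v \<in> lattice" "w \<in> lattice" "cross2 v w = 1" "g > 0" "B - A = real g *\<^sub>R v"
  shows "lattice_length A B = real g"
proof -
  let ?h = "\<lambda>k::nat. A + real k *\<^sub>R v"
  have v0: "v \<noteq> 0" using assms(4) by (auto simp: cross2_simps)
  have B: "B = A + real g *\<^sub>R v" using assms(6) by (metis add_diff_cancel_left' diff_add_cancel add.commute)
  have "closed_segment A B \<inter> lattice = ?h ` {..g}"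
  proof
    show "closed_segment A B \<inter> lattice \<subseteq> ?h ` {..g}"
    proof
      fix x assume x: "x \<in> closed_segment A B \<inter> lattice"
      then obtain t where t: "0 \<le> t" "t \<le> 1" "x = (1 - t) *\<^sub>R A + t *\<^sub>R B"
        by (auto simp: closed_segment_def)
      then have xt: "x = A + (t * g) *\<^sub>R v"
        by (simp add: B algebra_simps)
      then have "(t * g) *\<^sub>R v \<in> lattice"
        using lattice_closed(3)[of x A] x assms(1) by simp
      then obtain k :: int where k: "t * g = of_int k"
        using scaleR_in_lattice_imp_Ints[OF assms(3,4)] by (auto elim: Ints_cases)
      have "0 \<le> t * g" "t * g \<le> g"
        using t by (auto intro: mult_left_le_one_le)
      then have "0 \<le> k" "k \<le> int g" using k by linarith+
      then have "x = ?h (nat k)" "nat k \<le> g" using xt k by auto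
      then show "x \<in> ?h ` {..g}" by blast
    qed
    show "?h ` {..g} \<subseteq> closed_segment A B \<inter> lattice"
    proof
      fix x assume "x \<in> ?h ` {..g}"
      then obtain k where k: "k \<le> g" "x = ?h k" by auto
      have "x = (1 - k / g) *\<^sub>R A + (k / g) *\<^sub>R B"
        using assms(5) by (simp add: B k algebra_simps)
      then have "x \<in> closed_segment A B"
        using k assms(5) unfolding closed_segment_def by (auto intro!: exI[of _ "k / g"])
      moreover have "x \<in> lattice"
        using k assms by (auto intro!: lattice_closed)
      ultimately show "x \<in> closed_segment A B \<inter> lattice" by simp
    qed
  qed
  moreover have "inj_on ?h {..g}"
    using v0 by (auto simp: inj_on_def)
  ultimately show ?thesis
    by (simp add: lattice_length_def card_image)
qed

text \<open>Dividing \<open>B - A\<close> by the gcd \<open>g\<close> of its coordinates gives the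
  primitive vector; Bezout coefficients give a partner \<open>w\<close> of determinant 1 that
  certifies it.\<close>

lemma lattice_segment:
  assumes "A \<in> lattice" "B \<in> lattice" "A \<noteq> B"
  obtains g :: nat and v w where "g > 0" "v \<in> lattice" "w \<in> lattice" "cross2 v w = 1"
    "B - A = real g *\<^sub>R v" "primitive_along A B = v" "primitive_along B A = - v"
    "lattice_length A B = real g"
proof -
  have "B - A \<in> lattice" using assms lattice_closed by blast
  then obtain a b :: int where ab: "(B - A) $ 1 = of_int a" "(B - A) $ 2 = of_int b"
    unfolding lattice_def mem_Collect_eq by (metis Ints_cases)
  define g where "g = nat (gcd a b)"
  have "a \<noteq> 0 \<or> b \<noteq> 0" using assms(3) ab by (auto simp: vec_eq_iff forall_2)
  then have g: "int g = gcd a b" "g > 0" by (auto simp: g_def)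
  obtain a' b' where a': "a = int g * a'" "b = int g * b'"
    unfolding g by (meson dvdE gcd_dvd1 gcd_dvd2)
  obtain x y where "x * a + y * b = gcd a b"
    using bezout_int by blast
  then have "x * (int g * a') + y * (int g * b') = int g"
    unfolding g(1)[symmetric] unfolding a' .
  then have "int g * (x * a' + y * b') = int g" by (simp add: algebra_simps)
  then have xy: "x * a' + y * b' = 1" using g(2) by simp
  \<comment> \<open>\<open>w\<close> is the vector of Bezout coefficients turned by a right angle,
    so that \<open>cross2 v w\<close> becomes the Bezout sum.\<close>
  define v w :: "real^2" where "v = vector [of_int a', of_int b']" and "w = vector [- of_int y, of_int x]"
  have v: "v \<in> lattice" and w: "w \<in> lattice"
    by (auto simp: lattice_def v_def w_def forall_2)
  have "cross2 v w = of_int (x * a' + y * b')"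
    by (simp add: cross2_def v_def w_def)
  then have vw: "cross2 v w = 1" using xy by simp
  have BA: "B - A = real g *\<^sub>R v"
    using ab a' by (simp add: vec_eq_iff forall_2 v_def)
  have "A - B = real g *\<^sub>R (- v)"
    using BA by (metis minus_diff_eq scaleR_minus_right)
  then have "primitive_along B A = - v"
    using primitive_along_eq[of "- v" "- w" "real g" A B] v w vw g(2)
    by (simp add: cross2_simps lattice_closed)
  moreover have "primitive_along A B = v"
    using primitive_along_eq[OF v w vw _ BA] g(2) by simp
  ultimately show thesis
    using that[OF g(2) v w vw BA] lattice_length_eq[OF assms(1) v w vw g(2) BA] by blast
qed

section \<open>The lattice sine as a determinant\<close>

lemma affine_hull_line_cross2:
  assumes "v \<noteq> 0"
  shows "affine hull {P, P + v} = {z. cross2 v (z - P) = 0}"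
proof -
  have "z \<in> range (\<lambda>t. P + t *\<^sub>R v)" if z: "cross2 v (z - P) = 0" for z
  proof -
    obtain c where "z - P = c *\<^sub>R v"
      using cross2_eq_0_imp_scaleR[OF z assms] .
    then have "z = P + c *\<^sub>R v" by (simp add: algebra_simps)
    then show ?thesis by blast
  qed
  then have "range (\<lambda>t. P + t *\<^sub>R v) = {z. cross2 v (z - P) = 0}"
    by (auto simp: cross2_simps)
  then show ?thesis
    by (simp add: affine_hull_2_alt)
qed

text \<open>Everything is measured by the determinant with \<open>v\<close>, the primitive vector
  towards \<open>X\<close>. It is \<open>d\<close> on the primitive vector \<open>v'\<close> towards
  \<open>Y\<close> and \<open>s\<close>, the sign of \<open>d\<close>, on \<open>D - C\<close>.
  Taken on an expansion of \<open>v'\<close> in \<open>v\<close> and \<open>D - C\<close> it gives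
  \<open>d = x2 * s\<close>, so \<open>x2\<close> is the absolute value of \<open>d\<close>. Most of
  the proof evaluates the descriptions that lead to \<open>D\<close>.\<close>

theorem lsin_eq_abs_cross2:
  assumes "X \<in> lattice" "C \<in> lattice" "Y \<in> lattice" and nz: "cross2 (X - C) (Y - C) \<noteq> 0"
  shows "lsin X C Y = \<bar>cross2 (primitive_along C X) (primitive_along C Y)\<bar>"
proof -
  have "C \<noteq> X" "C \<noteq> Y" using nz by (auto simp: cross2_simps)
  obtain g :: nat and v w where v: "g > 0" "v \<in> lattice" "w \<in> lattice" "cross2 v w = 1"
    "X - C = real g *\<^sub>R v" "primitive_along C X = v"
    using lattice_segment[OF assms(2,1) \<open>C \<noteq> X\<close>] by metis
  obtain g' :: nat and v' w' where v': "g' > 0" "v' \<in> lattice" "w' \<in> lattice" "cross2 v' w' = 1"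
    "Y - C = real g' *\<^sub>R v'" "primitive_along C Y = v'"
    using lattice_segment[OF assms(2,3) \<open>C \<noteq> Y\<close>] by metis
  define d where "d = cross2 v v'"
  define s where "s = sgn d"
  have d0: "d \<noteq> 0" using nz by (auto simp: v v' d_def cross2_simps)
  have s: "s = 1 \<or> s = -1" "s * d = \<bar>d\<bar>" "s \<noteq> 0" "s * s = 1" "s \<in> \<int>"
    using d0 by (auto simp: s_def sgn_if)
  have v0: "v \<noteq> 0" using v(4) by (auto simp: cross2_simps)
  have ray: "ray C Y = {C + t *\<^sub>R v' | t. t \<ge> 0}"
  proof -
    have "\<exists>t'\<ge>0. C + t *\<^sub>R v' = C + t' *\<^sub>R (real g' *\<^sub>R v')" if "t \<ge> 0" for t
      using that v'(1) by (intro exI[of _ "t / g'"]) auto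
    then show ?thesis
      unfolding ray_def v'(5) by (fastforce intro!: mult_nonneg_nonneg)
  qed
  \<comment> \<open>Of the two lattice lines at levels 1 and -1, the ray towards \<open>Y\<close>
    meets the one whose level has the sign of \<open>d\<close>; it does so at parameter
    \<open>1 / \<bar>d\<bar>\<close>.\<close>
  define L where "L = {z. cross2 v (z - C) = s}"
  define Q where "Q = C + (1 / \<bar>d\<bar>) *\<^sub>R v'"
  have L_ray: "L \<inter> ray C Y = {Q}"
  proof -
    have "t = 1 / \<bar>d\<bar>" if "t * d = s" for t
      using that s d0 by (metis abs_mult_self_eq mult.assoc mult.commute nonzero_eq_divide_eq abs_eq_0)
    moreover have "1 / \<bar>d\<bar> * d = s"
      using s d0 by (auto simp: abs_if field_simps split: if_splits)
    ultimately show ?thesis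
      unfolding ray L_def Q_def by (auto simp: cross2_simps d_def[symmetric])
  qed
  have line: "lsin_line X C Y = L"
    unfolding lsin_line_def v(6)
  proof (rule the_equality)
    have "affine hull {C + s *\<^sub>R w, (C + s *\<^sub>R w) + v} = L"
      unfolding affine_hull_line_cross2[OF v0] L_def by (simp add: cross2_simps v(4) algebra_simps)
    moreover have "lattice_basis v (C + s *\<^sub>R w - C)"
      using v s lattice_closed by (auto simp: lattice_basis_iff cross2_simps)
    moreover have "C + s *\<^sub>R w \<in> lattice"
      using v assms s by (intro lattice_closed)
    ultimately show "(\<exists>P\<in>lattice. lattice_basis v (P - C) \<and> L = affine hull {P, P + v})
        \<and> L \<inter> ray C Y \<noteq> {}"
      using L_ray by blast
  next
    fix l assume "(\<exists>P\<in>lattice. lattice_basis v (P - C) \<and> l = affine hull {P, P + v})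
        \<and> l \<inter> ray C Y \<noteq> {}"
    then obtain P t where P: "lattice_basis v (P - C)" "l = affine hull {P, P + v}"
      and t: "t \<ge> 0" "C + t *\<^sub>R v' \<in> l"
      unfolding ray by blast
    \<comment> \<open>\<open>e\<close> is the level of the competing line. Meeting the ray at a
      parameter \<open>t \<ge> 0\<close> means \<open>t * d = e\<close>, which forces
      \<open>e\<close> to have the sign of \<open>d\<close>.\<close>
    define e where "e = cross2 v (P - C)"
    have e: "\<bar>e\<bar> = 1" using P(1) by (simp add: lattice_basis_iff e_def)
    have l: "l = {z. cross2 v (z - C) = e}"
      unfolding P(2) affine_hull_line_cross2[OF v0] e_def by (auto simp: cross2_simps)
    have te: "t * d = e" using t(2) by (simp add: l cross2_simps d_def)
    then have "t > 0" using e t(1) by (cases "t = 0") auto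
    then have "sgn e = s" using te by (auto simp: sgn_mult s_def)
    moreover have "sgn e = e" using e by (auto simp: abs_if split: if_splits)
    ultimately show "l = L" by (simp add: l L_def)
  qed
  have Q: "lsin_Q X C Y = Q"
    unfolding lsin_Q_def line L_ray by simp
  have QL: "Q \<in> L" using L_ray by auto
  have "cross2 v (Q - (C + s *\<^sub>R w)) = 0"
    using QL by (simp add: L_def cross2_simps v(4))
  then obtain q where "Q - (C + s *\<^sub>R w) = q *\<^sub>R v"
    using cross2_eq_0_imp_scaleR v0 by blast
  then have q: "Q = C + s *\<^sub>R w + q *\<^sub>R v" by (simp add: algebra_simps)
  \<comment> \<open>\<open>Q\<close> lies on the line through \<open>C\<close> and \<open>Y\<close>.
    This ties \<open>cross2 w v'\<close> to \<open>q\<close>, so that the side on which the lattice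
    point \<open>?p k\<close> of \<open>L\<close> lies depends only on the sign of
    \<open>k - q\<close>.\<close>
  have "cross2 (Q - C) v' = 0" by (simp add: Q_def cross2_simps)
  then have swd: "s * cross2 w v' = - q * d"
    unfolding q d_def by (simp add: cross2_simps)
  let ?D = "\<lambda>D. D \<in> L \<and> D \<in> lattice \<and> osgn X C Y * osgn D C Y < 0"
  let ?p = "\<lambda>k::int. C + s *\<^sub>R w + of_int k *\<^sub>R v"
  have side: "osgn X C Y * osgn (?p k) C Y < 0 \<longleftrightarrow> of_int k < q" for k
  proof -
    have "cross2 (X - C) (Y - C) = real g * (real g' * d)"
      unfolding v(5) v'(5) by (simp add: cross2_simps d_def)
    moreover have "cross2 (?p k - C) (Y - C) = real g' * ((k - q) * d)"
      unfolding v'(5) using swd by (simp add: cross2_simps d_def algebra_simps)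
    ultimately have "osgn X C Y * osgn (?p k) C Y = sgn d * (sgn (k - q) * sgn d)"
      using v(1) v'(1) by (simp add: osgn_eq_cross2 sgn_mult)
    also have "\<dots> = sgn (k - q)" using s(4) by (simp add: s_def algebra_simps)
    finally show ?thesis by simp
  qed
  have pL: "?p k \<in> L \<and> ?p k \<in> lattice" for k
    using v assms s lattice_closed by (auto simp: L_def cross2_simps)
  have Lp: "\<exists>k. D = ?p k" if D: "D \<in> L" "D \<in> lattice" for D
  proof -
    have "cross2 v (D - (C + s *\<^sub>R w)) = 0"
      using D by (simp add: L_def cross2_simps v(4))
    then obtain c where c: "D - (C + s *\<^sub>R w) = c *\<^sub>R v"
      using cross2_eq_0_imp_scaleR v0 by blast
    have "D - (C + s *\<^sub>R w) \<in> lattice"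
      using D assms v s by (intro lattice_closed)
    then obtain k :: int where "c = of_int k"
      using scaleR_in_lattice_imp_Ints[OF v(3,4)] unfolding c by (auto elim: Ints_cases)
    with c show ?thesis by (auto simp: algebra_simps)
  qed
  have dist: "dist Q (?p k) = \<bar>q - k\<bar> * norm v" for k
  proof -
    have "Q - ?p k = (q - k) *\<^sub>R v" by (simp add: q algebra_simps)
    then show ?thesis by (simp add: dist_norm)
  qed
  \<comment> \<open>The largest integer strictly below \<open>q\<close>. The floor would fail for
    integer \<open>q\<close>, where \<open>Q\<close> itself is a lattice point but lies on the line
    through \<open>C\<close> and \<open>Y\<close>, not beyond it.\<close>
  define k0 where "k0 = \<lceil>q\<rceil> - 1"
  have k0: "of_int k0 < q" "\<And>k::int. of_int k < q \<Longrightarrow> k \<le> k0"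
    unfolding k0_def by linarith+
  \<comment> \<open>The value of \<open>arg_min\<close> satisfies its constraint once a minimiser
    exists, and \<open>?p k0\<close> is one.\<close>
  have D: "?D (lsin_D X C Y)"
    unfolding lsin_D_def line Q
  proof (rule arg_minI[where x = "?p k0"])
    show "?D (?p k0)" using pL side k0 by simp
    fix y assume y: "?D y"
    then obtain k where k: "y = ?p k" using Lp by blast
    with y have "of_int k < q" using side by blast
    then have "\<bar>q - k0\<bar> \<le> \<bar>q - k\<bar>" using k0(2)[of k] k0(1) by linarith
    then show "\<not> dist Q y < dist Q (?p k0)"
      unfolding k dist by (simp add: mult_right_mono not_less)
  qed
  define u where "u = lsin_D X C Y - C"
  have u: "cross2 v u = s" using D by (simp add: L_def u_def)
  have "lsin X C Y = \<bar>d\<bar>"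
    unfolding lsin_def v(6) v'(6) u_def[symmetric]
  proof (rule the_equality)
    have "v' = s *\<^sub>R (s *\<^sub>R v')" using s by simp
    also have "s *\<^sub>R v' = cross2 v' u *\<^sub>R v + d *\<^sub>R u"
      using cross2_decomp[of v u v'] u by (simp add: d_def)
    finally have "v' = (s * cross2 v' u) *\<^sub>R v + \<bar>d\<bar> *\<^sub>R u"
      using s by (simp add: scaleR_right_distrib)
    then show "\<exists>x1. v' = x1 *\<^sub>R v + \<bar>d\<bar> *\<^sub>R u" by blast
    fix x2 assume "\<exists>x1. v' = x1 *\<^sub>R v + x2 *\<^sub>R u"
    then obtain x1 where x1: "v' = x1 *\<^sub>R v + x2 *\<^sub>R u" ..
    \<comment> \<open>Taking the determinant with \<open>v\<close> removes the \<open>x1\<close>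
      term.\<close>
    have "d = x2 * s" unfolding d_def x1 by (simp add: cross2_simps u)
    then show "x2 = \<bar>d\<bar>" using s by (metis mult.assoc mult.commute mult_1)
  qed
  then show ?thesis by (simp add: d_def v(6) v'(6))
qed

section \<open>Segments and angles as seen from the point at unit distance\<close>

lemma broken_line_cross2_nonzero:
  assumes "A \<noteq> B" "\<not> collinear (closed_segment A B \<union> closed_segment B C)"
  shows "cross2 (A - B) (C - B) \<noteq> 0"
proof
  assume "cross2 (A - B) (C - B) = 0"
  then obtain c where "C - B = c *\<^sub>R (A - B)"
    using cross2_eq_0_imp_scaleR assms(1) by (metis right_minus_eq)
  then have "collinear {A, B, C}"
    by (subst collinear_3) (auto simp: collinear_lemma)
  then have "collinear (convex hull {A, B, C})"
    by (metis collinear_affine_hull_collinear collinear_subset convex_hull_subset_affine_hull)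
  moreover have "closed_segment A B \<union> closed_segment B C \<subseteq> convex hull {A, B, C}"
    unfolding segment_convex_hull by (intro Un_least hull_mono) auto
  ultimately show False
    using assms(2) collinear_subset by blast
qed

definition unit_direction :: "real^2 \<Rightarrow> real^2 \<Rightarrow> real^2 \<Rightarrow> real^2" where
  "unit_direction V A B = osgn A V B *\<^sub>R primitive_along A B"

text \<open>Unit distance makes the determinant \<open>e\<close> of \<open>A - V\<close> and the
  primitive vector a sign. As \<open>B - A\<close> is a positive multiple of that vector,
  \<open>osgn A V B\<close> equals \<open>e\<close>, and \<open>e * e = 1\<close> gives the
  remaining identities.\<close>

lemma unit_distance_segment:
  assumes "A \<in> lattice" "B \<in> lattice" "A \<noteq> B"
    and basis: "lattice_basis (primitive_along A B) (V - A)"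
  shows "unit_direction V A B \<in> lattice"
    and "cross2 (A - V) (unit_direction V A B) = 1"
    and "cross2 (A - V) (B - V) = osgn A V B * lattice_length A B"
    and "cross2 (A - V) (B - V) \<noteq> 0"
    and "B - V = (A - V) + cross2 (A - V) (B - V) *\<^sub>R unit_direction V A B"
proof -
  obtain g :: nat and v w where v: "g > 0" "v \<in> lattice" "B - A = real g *\<^sub>R v"
      "primitive_along A B = v" "lattice_length A B = real g"
    using lattice_segment[OF assms(1-3)] by metis
  define e where "e = cross2 (A - V) v"
  have "e = cross2 v (V - A)"
    by (simp add: e_def cross2_def algebra_simps)
  then have "\<bar>e\<bar> = 1" using basis by (simp add: lattice_basis_iff v(4))
  then have e: "e * e = 1" "sgn e = e" "e \<in> \<int>" "e \<noteq> 0"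
    by (auto simp: abs_if split: if_splits)
  have BV: "B - V = (A - V) + real g *\<^sub>R v" using v(3) by (simp add: algebra_simps)
  have c: "cross2 (A - V) (B - V) = real g * e"
    unfolding BV by (simp add: cross2_simps e_def)
  then have o: "osgn A V B = e"
    using v(1) e by (simp add: osgn_eq_cross2 sgn_mult)
  have u: "unit_direction V A B = e *\<^sub>R v" by (simp add: unit_direction_def o v(4))
  show "unit_direction V A B \<in> lattice" using u v e lattice_closed by simp
  show "cross2 (A - V) (unit_direction V A B) = 1"
    using e(1) by (simp add: u cross2_simps(6) e_def)
  show "cross2 (A - V) (B - V) = osgn A V B * lattice_length A B" by (simp add: c o v(5))
  show "cross2 (A - V) (B - V) \<noteq> 0" using c v(1) e by simp
  show "B - V = (A - V) + cross2 (A - V) (B - V) *\<^sub>R unit_direction V A B"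
    unfolding c u using e(1) by (simp add: BV algebra_simps)
qed

text \<open>The angle at \<open>B\<close> is spanned by \<open>- v\<close> and \<open>v'\<close>,
  since its first leg runs backwards along the first segment. This reversal is the source of the
  minus sign; sign times absolute value then restores the determinant.\<close>

lemma unit_distance_angle:
  assumes "A \<in> lattice" "B \<in> lattice" "C \<in> lattice" "A \<noteq> B" "B \<noteq> C"
    and "cross2 (A - B) (C - B) \<noteq> 0"
  shows "osgn A V B * osgn B V C * osgn A B C * lsin A B C =
    - cross2 (unit_direction V A B) (unit_direction V B C)"
proof -
  obtain g :: nat and v w where v: "g > 0" "B - A = real g *\<^sub>R v"
      "primitive_along A B = v" "primitive_along B A = - v"
    using lattice_segment[OF assms(1,2,4)] by metis
  obtain g' :: nat and v' w' where v': "g' > 0" "C - B = real g' *\<^sub>R v'"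
      "primitive_along B C = v'"
    using lattice_segment[OF assms(2,3,5)] by metis
  have "A - B = - (real g *\<^sub>R v)" using v(2) by (metis minus_diff_eq)
  then have "osgn A B C = - sgn (cross2 v v')"
    using v(1) v'(1) by (simp add: osgn_eq_cross2 v'(2) cross2_simps sgn_mult sgn_minus)
  moreover have "lsin A B C = \<bar>cross2 v v'\<bar>"
    using lsin_eq_abs_cross2[OF assms(1-3,6)] by (simp add: v(4) v'(3) cross2_simps)
  ultimately have "osgn A B C * lsin A B C = - cross2 v v'"
    by (simp add: sgn_mult_abs)
  then show ?thesis
    by (simp add: unit_direction_def v(3) v'(3) cross2_simps mult.assoc)
qed

text \<open>Both vectors have determinant 1 with \<open>p\<close>, so they differ by a multiple of
  \<open>p\<close>; \<open>cross2_decomp\<close> gives the factor.\<close>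

lemma unit_direction_step:
  assumes "cross2 p u = 1" "cross2 p u' = 1"
  shows "u' = u - cross2 u u' *\<^sub>R p"
  using cross2_decomp[of p u u'] assms cross2_skew[of u u'] by (simp add: add.commute)

section \<open>Splitting the sequence into its even and odd entries\<close>

lemma signed_length_sine_eq_iff:
  "signed_length_sine n A V = signed_length_sine n B W \<longleftrightarrow>
    (\<forall>j<n. osgn (A j) V (A (j + 1)) * lattice_length (A j) (A (j + 1)) =
       osgn (B j) W (B (j + 1)) * lattice_length (B j) (B (j + 1))) \<and>
    (\<forall>j. j + 1 < n \<longrightarrow>
       osgn (A j) V (A (j + 1)) * osgn (A (j + 1)) V (A (j + 2))
         * osgn (A j) (A (j + 1)) (A (j + 2)) * lsin (A j) (A (j + 1)) (A (j + 2)) =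
       osgn (B j) W (B (j + 1)) * osgn (B (j + 1)) W (B (j + 2))
         * osgn (B j) (B (j + 1)) (B (j + 2)) * lsin (B j) (B (j + 1)) (B (j + 2)))"
proof -
  have split: "(\<forall>k\<in>set [0..<2 * n - 1]. P k) \<longleftrightarrow> (\<forall>j<n. P (2 * j)) \<and> (\<forall>j. j + 1 < n \<longrightarrow> P (2 * j + 1))"
    for P :: "nat \<Rightarrow> bool"
  proof (intro iffI conjI allI impI ballI)
    fix k assume P: "(\<forall>j<n. P (2 * j)) \<and> (\<forall>j. j + 1 < n \<longrightarrow> P (2 * j + 1))" and "k \<in> set [0..<2 * n - 1]"
    then have k: "k < 2 * n - 1" by simp
    show "P k"
    proof (cases "even k")
      case True
      then obtain j where "k = 2 * j" by (elim evenE)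
      then show ?thesis using P k by simp
    next
      case False
      then obtain j where "k = 2 * j + 1" by (elim oddE)
      then show ?thesis using P k by simp
    qed
  qed auto
  show ?thesis
    unfolding signed_length_sine_def Let_def map_eq_conv split by simp
qed

section \<open>Integer matrices of determinant one\<close>

lemma unimodular_in_GL2_int:
  assumes "int_matrix M" "det M = 1"
  shows "M \<in> GL2_int"
proof -
  \<comment> \<open>The adjugate of \<open>M\<close>, which is its inverse because the determinant
    is 1.\<close>
  define N :: "real^2^2"
    where "N = vector [vector [M $ 2 $ 2, - (M $ 1 $ 2)], vector [- (M $ 2 $ 1), M $ 1 $ 1]]"
  have "int_matrix N"
    using assms(1) by (simp add: int_matrix_def N_def forall_2)
  moreover have "M ** N = mat 1" "N ** M = mat 1"
    using assms(2)
    by (simp_all add: vec_eq_iff forall_2 matrix_matrix_mult_def sum_2 N_def mat_def det_2 algebra_simps)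
  ultimately show ?thesis
    using assms(1) by (auto simp: GL2_int_def)
qed

text \<open>\<open>M\<close> is the matrix with columns \<open>q\<close>, \<open>w\<close> times the
  inverse of the matrix with columns \<open>p\<close>, \<open>u\<close>. That inverse is the
  adjugate, so the entries of \<open>M\<close> are integers.\<close>

lemma unimodular_basis_change:
  assumes "p \<in> lattice" "u \<in> lattice" "cross2 p u = 1"
    and "q \<in> lattice" "w \<in> lattice" "cross2 q w = 1"
  obtains M where "M \<in> GL2_int" "det M = 1" "M *v p = q" "M *v u = w"
proof -
  define M :: "real^2^2" where
    "M = (\<chi> i. vector [u $ 2 * q $ i - p $ 2 * w $ i, p $ 1 * w $ i - u $ 1 * q $ i])"
  have M: "M *v x = cross2 x u *\<^sub>R q + cross2 p x *\<^sub>R w" for x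
    by (simp add: vec_eq_iff forall_2 matrix_vector_mult_def sum_2 M_def cross2_def algebra_simps)
  have "int_matrix M"
    using assms by (auto simp: int_matrix_def M_def forall_2 lattice_def)
  moreover have "det M = cross2 p u * cross2 q w"
    by (simp add: det_2 M_def cross2_def algebra_simps)
  then have "det M = 1" by (simp add: assms)
  ultimately have "M \<in> GL2_int" using unimodular_in_GL2_int by blast
  with \<open>det M = 1\<close> show thesis
    using that M[of p] M[of u] assms by (simp add: cross2_simps)
qed

lemma cross2_matrix: "cross2 (M *v x) (M *v y) = det M * cross2 x y"
  by (simp add: cross2_def matrix_vector_mult_def sum_2 det_2 algebra_simps)

section \<open>The recursion along a broken line\<close>

locale unit_distance_broken_line =
  fixes n :: nat and A :: "nat \<Rightarrow> real^2" and V :: "real^2"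
  assumes V: "V \<in> lattice" and line: "lattice_broken_line n A" and unit: "on_unit_distance n A V"
begin

definition p :: "nat \<Rightarrow> real^2" where "p i = A i - V"
definition u :: "nat \<Rightarrow> real^2" where "u i = unit_direction V (A i) (A (i + 1))"

lemma n_pos: "n \<ge> 1"
  using line by (simp add: lattice_broken_line_def)

lemma vertex_lattice: "i \<le> n \<Longrightarrow> A i \<in> lattice"
  using line by (simp add: lattice_broken_line_def)

lemma vertex_neq: "i < n \<Longrightarrow> A i \<noteq> A (i + 1)"
  using line unfolding lattice_broken_line_def
  by (metis Suc_eq_plus1 Suc_leI atLeastAtMost_iff diff_Suc_1 le_add2)

lemma basis: "i < n \<Longrightarrow> lattice_basis (primitive_along (A i) (A (i + 1))) (V - A i)"
  using unit unfolding on_unit_distance_def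
  by (metis Suc_eq_plus1 Suc_leI atLeastAtMost_iff diff_Suc_1 le_add2)

lemma angle_nonzero: "i + 1 < n \<Longrightarrow> cross2 (A i - A (i + 1)) (A (i + 2) - A (i + 1)) \<noteq> 0"
proof (rule broken_line_cross2_nonzero)
  assume i: "i + 1 < n"
  then show "A i \<noteq> A (i + 1)" using vertex_neq by simp
  have "i + 1 \<in> {1..<n}" using i by simp
  then show "\<not> collinear (closed_segment (A i) (A (i + 1)) \<union> closed_segment (A (i + 1)) (A (i + 2)))"
    using line unfolding lattice_broken_line_def by fastforce
qed

lemma p_lattice: "i \<le> n \<Longrightarrow> p i \<in> lattice"
  using vertex_lattice V by (simp add: p_def lattice_closed)

lemma segment:
  assumes "i < n"
  shows "u i \<in> lattice" "cross2 (p i) (u i) = 1" "cross2 (p i) (p (i + 1)) \<noteq> 0"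
    "osgn (A i) V (A (i + 1)) * lattice_length (A i) (A (i + 1)) = cross2 (p i) (p (i + 1))"
    "p (i + 1) = p i + cross2 (p i) (p (i + 1)) *\<^sub>R u i"
  unfolding p_def u_def
  using unit_distance_segment[of "A i" "A (i + 1)" V] assms vertex_lattice vertex_neq basis
  by auto

lemma angle:
  assumes "i + 1 < n"
  shows "osgn (A i) V (A (i + 1)) * osgn (A (i + 1)) V (A (i + 2))
    * osgn (A i) (A (i + 1)) (A (i + 2)) * lsin (A i) (A (i + 1)) (A (i + 2)) =
    - cross2 (u i) (u (i + 1))"
  using unit_distance_angle[of "A i" "A (i + 1)" "A (i + 2)" V] assms
    vertex_lattice vertex_neq[of i] vertex_neq[of "i + 1"] angle_nonzero
  by (simp add: u_def)

text \<open>\<open>p (i + 1)\<close> differs from \<open>p i\<close> by a multiple of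
  \<open>u i\<close>, so \<open>u i\<close> keeps determinant 1 with the new vertex, just as
  \<open>u (i + 1)\<close> has it.\<close>

lemma u_step:
  assumes "i + 1 < n"
  shows "u (i + 1) = u i - cross2 (u i) (u (i + 1)) *\<^sub>R p (i + 1)"
proof (rule unit_direction_step)
  have "cross2 (p (i + 1)) (u i) = cross2 (p i + cross2 (p i) (p (i + 1)) *\<^sub>R u i) (u i)"
    using segment(5)[of i] assms by simp
  then show "cross2 (p (i + 1)) (u i) = 1"
    using segment(2)[of i] assms by (simp add: cross2_simps)
  show "cross2 (p (i + 1)) (u (i + 1)) = 1"
    using segment(2)[of "i + 1"] assms by simp
qed

text \<open>With \<open>u\<close> expressed through \<open>p\<close> alone, a linear map of
  determinant 1 that carries one vertex sequence to another also carries the directions along,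
  without a study of its effect on primitive vectors.\<close>

lemma u_eq:
  assumes "i < n"
  shows "u i = (1 / cross2 (p i) (p (i + 1))) *\<^sub>R (p (i + 1) - p i)"
proof -
  have "p (i + 1) - p i = cross2 (p i) (p (i + 1)) *\<^sub>R u i"
    using segment(5)[OF assms] by (metis add_diff_cancel_left')
  then show ?thesis using segment(3)[OF assms] by simp
qed

end

section \<open>Equal sequences and equivalence under proper lattice-affine maps\<close>

theorem theorem3p4:
  fixes n :: nat and A B :: "nat \<Rightarrow> real^2" and V1 V2 :: "real^2"
  assumes "V1 \<in> lattice" and "V2 \<in> lattice"
    and "lattice_broken_line n A" and "on_unit_distance n A V1"
    and "lattice_broken_line n B" and "on_unit_distance n B V2"
  shows "signed_length_sine n A V1 = signed_length_sine n B V2 \<longleftrightarrow>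
         (\<exists>\<xi>. proper_lattice_affine \<xi> \<and> \<xi> V1 = V2 \<and> (\<forall>i\<le>n. \<xi> (A i) = B i))"
proof -
  interpret a: unit_distance_broken_line n A V1 using assms by unfold_locales
  interpret b: unit_distance_broken_line n B V2 using assms by unfold_locales
  have seq: "signed_length_sine n A V1 = signed_length_sine n B V2 \<longleftrightarrow>
    (\<forall>j<n. cross2 (a.p j) (a.p (j + 1)) = cross2 (b.p j) (b.p (j + 1))) \<and>
    (\<forall>j. j + 1 < n \<longrightarrow> cross2 (a.u j) (a.u (j + 1)) = cross2 (b.u j) (b.u (j + 1)))"
    unfolding signed_length_sine_eq_iff
    \<comment> \<open>The identities hold only for indices in range; \<open>imp_cong\<close> makes
      the range condition available while rewriting. The minus signs of the angle entries
      cancel.\<close>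
    by (simp only: a.segment(4) b.segment(4) a.angle b.angle neg_equal_iff_equal cong: imp_cong)
  show ?thesis
  proof
    assume "signed_length_sine n A V1 = signed_length_sine n B V2"
    then have
      len: "\<And>j. j < n \<Longrightarrow> cross2 (a.p j) (a.p (j + 1)) = cross2 (b.p j) (b.p (j + 1))" and
      sin: "\<And>j. j + 1 < n \<Longrightarrow> cross2 (a.u j) (a.u (j + 1)) = cross2 (b.u j) (b.u (j + 1))"
      unfolding seq by auto
    have "0 < n" using a.n_pos by simp
    then obtain M where M: "M \<in> GL2_int" "det M = 1" "M *v a.p 0 = b.p 0" "M *v a.u 0 = b.u 0"
      using unimodular_basis_change[of "a.p 0" "a.u 0" "b.p 0" "b.u 0"]
        a.p_lattice b.p_lattice a.segment(1,2) b.segment(1,2) by blast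
    \<comment> \<open>Kept apart from the induction because the last vertex has no outgoing segment:
      \<open>p n\<close> is reached by one more such step from index \<open>n - 1\<close>.\<close>
    have p_step: "M *v a.p (i + 1) = b.p (i + 1)"
      if "i < n" "M *v a.p i = b.p i" "M *v a.u i = b.u i" for i
      by (subst a.segment(5)[OF that(1)], subst b.segment(5)[OF that(1)])
        (simp only: matrix_vector_right_distrib matrix_vector_mult_scaleR that(2,3) len[OF that(1)])
    have ind: "M *v a.p i = b.p i \<and> M *v a.u i = b.u i" if "i < n" for i
      using that
    proof (induction i)
      case 0
      show ?case using M by simp
    next
      case (Suc i)
      then have IH: "M *v a.p i = b.p i" "M *v a.u i = b.u i" and i: "i < n" "i + 1 < n" by auto
      have P: "M *v a.p (i + 1) = b.p (i + 1)" using p_step[OF i(1) IH] .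
      moreover have "M *v a.u (i + 1) = b.u (i + 1)"
        by (subst a.u_step[OF i(2)], subst b.u_step[OF i(2)])
          (simp only: matrix_vector_mult_diff_distrib matrix_vector_mult_scaleR IH P sin[OF i(2)])
      ultimately show ?case by simp
    qed
    have Mp: "M *v a.p i = b.p i" if "i \<le> n" for i
    proof (cases i)
      case 0
      then show ?thesis using M by simp
    next
      case (Suc k)
      then show ?thesis using ind[of k] p_step[of k] that by simp
    qed
    \<comment> \<open>The translation forced by sending \<open>V1\<close> to
      \<open>V2\<close>.\<close>
    define b where "b = V2 - M *v V1"
    have "M *v V1 \<in> lattice"
      using M(1) assms(1) by (auto simp: GL2_int_def int_matrix_def lattice_def matrix_vector_mult_def)
    then have "proper_lattice_affine (\<lambda>x. M *v x + b)"
      using M assms(2) lattice_closed unfolding proper_lattice_affine_def b_def by blast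
    moreover have "M *v A i + b = B i" if "i \<le> n" for i
      using Mp[OF that]
      by (simp add: a.p_def b.p_def b_def matrix_vector_mult_diff_distrib algebra_simps)
    ultimately show "\<exists>\<xi>. proper_lattice_affine \<xi> \<and> \<xi> V1 = V2 \<and> (\<forall>i\<le>n. \<xi> (A i) = B i)"
      by (intro exI[of _ "\<lambda>x. M *v x + b"]) (simp add: b_def)
  next
    assume "\<exists>\<xi>. proper_lattice_affine \<xi> \<and> \<xi> V1 = V2 \<and> (\<forall>i\<le>n. \<xi> (A i) = B i)"
    then obtain M b where M: "det M = 1" "M *v V1 + b = V2" "\<And>i. i \<le> n \<Longrightarrow> M *v A i + b = B i"
      unfolding proper_lattice_affine_def by blast
    have p: "b.p i = M *v a.p i" if "i \<le> n" for i
    proof -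
      have "b.p i = (M *v A i + b) - (M *v V1 + b)"
        unfolding b.p_def M(2) M(3)[OF that] ..
      then show ?thesis by (simp add: a.p_def matrix_vector_mult_diff_distrib)
    qed
    \<comment> \<open>Determinants are multiplied by \<open>det M\<close>, which is 1.\<close>
    then have len: "cross2 (b.p i) (b.p (i + 1)) = cross2 (a.p i) (a.p (i + 1))" if "i < n" for i
      using that by (simp add: cross2_matrix M(1))
    have u: "b.u i = M *v a.u i" if "i < n" for i
      unfolding a.u_eq[OF that] b.u_eq[OF that] len[OF that]
      using that p by (simp add: matrix_vector_mult_scaleR matrix_vector_mult_diff_distrib)
    show "signed_length_sine n A V1 = signed_length_sine n B V2"
      unfolding seq using len u by (simp add: cross2_matrix M(1))
  qed
qed

end
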